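(* Let $\mathcal{B}=(e_n)_{n=1}^\infty$ be a basis of a Banach space $\mathbb{X}$ and let $\omega$ be a weight on subsets of $\mathbb{N}$. The following are equivalent: (1) $\mathcal{B}$ is $\omega$-almost greedy; (2) $\mathcal{B}$ is quasi-greedy and satisfies $\omega$-Property (A); (3) $\mathcal{B}$ is quasi-greedy and $\omega$-disjoint superdemocratic; (4) $\mathcal{B}$ is quasi-greedy and $\omega$-disjoint democratic.
   Context: $\mathbb{X}$ is a Banach space over $\mathbb{K}=\mathbb{R}$ or $\mathbb{C}$. A basis of $\mathbb{X}$ means a semi-normalized Schauder basis $(e_n)_{n=1}^\infty$, i.e. $0<\inf_n\|e_n\|\le\sup_n\|e_n\|<\infty$, with biorthogonal functionals $(e_n^* )_{n=1}^\infty\subset\mathbb{X}^*$. $\mathbb{N}^{<\infty}$ is the set of finite subsets of $\mathbb{N}$. A weight on sets is a function $\omega:\mathcal{P}(\mathbb{N})\to[0,\infty]$, whose value at $A$ is written $w(A)$, such that $w(\emptyset)=0$ and $w(A)\in(0,\infty]$ for every nonempty $A\subset\mathbb{N}$. Greedy sets: for $x\in\mathbb{X}$, $m\in\mathbb{N}$, a greedy set of order $m$ of $x$ is a set $\Lambda_m(x)\subset\mathbb{N}$ with $|\Lambda_m(x)|=m$ and $\min_{n\in\Lambda_m(x)}|e_n^*(x)|\ge\max_{n\notin\Lambda_m(x)}|e_n^*(x)|$; the corresponding greedy sum is $G_m(x)=\sum_{n\in\Lambda_m(x)}e_n^*(x)e_n$. $\mathcal{B}$ is $\omega$-almost greedy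 if there is $C\ge1$ such that for all $x\in\mathbb{X}$, $m\in\mathbb{N}$ and all greedy sets $\Lambda_m(x)$, $\|x-G_m(x)\|\le C\widetilde{\sigma}^\omega_{\Lambda_m(x)}(x)$, where for $B\subset\mathbb{N}$ $$\widetilde\sigma^\omega_B(x)=\inf\{\|x-P_A(x)\|: A\in\mathbb{N}^{<\infty},\ w(A\setminus B)\le w(B\setminus A)\},\qquad P_A(x)=\sum_{n\in A}e_n^*(x)e_n.$$ $\mathcal{B}$ is quasi-greedy if there is $C\ge1$ with $\|x-G_m(x)\|\le C\|x\|$ for all $x\in\mathbb{X}$, $m\in\mathbb{N}$ and all greedy sets $\Lambda_m(x)$. Signs: $\varepsilon=(\varepsilon_n)_{n=1}^\infty\subset\mathbb{K}$ with $|\varepsilon_n|=1$; $1_A=\sum_{n\in A}e_n$, $1_{\varepsilon A}=\sum_{n\in A}\varepsilon_ne_n$. $\operatorname{supp}(x)=\{n:e_n^*(x)\ne0\}$, $\|x\|_\infty=\sup_n|e_n^*(x)|$. $\mathcal{B}$ satisfies $\omega$-Property (A) if there is $C\ge1$ such that $\|x+1_{\varepsilon A}\|\le C\|x+1_{\delta B}\|$ for all $A,B\in\mathbb{N}^{<\infty}$ with $w(A)\le w(B)$, all signs $\varepsilon,\delta$, and all $x\in\mathbb{X}$ with $\|x\|_\infty\le1$ such that $A$, $B$, $\operatorname{supp}(x)$ are pairwise disjoint. $\mathcal{B}$ is $\omega$-disjoint democratic (respectively $\omega$-disjoint superdemocratic) if there is $C\ge1$ such that $\|1_A\|\le C\|1_B\|$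 (respectively $\|1_{\varepsilon A}\|\le C\|1_{\delta B}\|$) for all $A,B\in\mathbb{N}^{<\infty}$ with $w(A)\le w(B)$ and $A\cap B=\emptyset$ (respectively, and all signs $\varepsilon,\delta$). *)

theory Defs
  imports "HOL-Analysis.Analysis"
begin

text \<open>
  The scalar field \<open>\<K>\<close> is a type of the following class, whose models are, up to isometric
  isomorphism, exactly \<open>\<real>\<close> and \<open>\<complex>\<close>.
\<close>

class real_or_complex = real_normed_field +
  assumes isometric_real_or_complex:
    "\<exists>\<phi> :: 'a \<Rightarrow> complex.
       (\<forall>x y. \<phi> (x + y) = \<phi> x + \<phi> y) \<and>
       (\<forall>x y. \<phi> (x * y) = \<phi> x * \<phi> y) \<and>
       (\<forall>r x. \<phi> (r *\<^sub>R x) = r *\<^sub>R \<phi> x) \<and>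
       (\<forall>x. norm (\<phi> x) = norm x) \<and>
       (range \<phi> = \<real> \<or> range \<phi> = UNIV)"

instance real :: real_or_complex
proof
  show "\<exists>\<phi> :: real \<Rightarrow> complex.
       (\<forall>x y. \<phi> (x + y) = \<phi> x + \<phi> y) \<and>
       (\<forall>x y. \<phi> (x * y) = \<phi> x * \<phi> y) \<and>
       (\<forall>r x. \<phi> (r *\<^sub>R x) = r *\<^sub>R \<phi> x) \<and>
       (\<forall>x. norm (\<phi> x) = norm x) \<and>
       (range \<phi> = \<real> \<or> range \<phi> = UNIV)"
    by (rule exI[of _ complex_of_real]) (auto simp: Reals_def scaleR_conv_of_real)
qed

instance complex :: real_or_complex
proof
  show "\<exists>\<phi> :: complex \<Rightarrow> complex.
       (\<forall>x y. \<phi> (x + y) = \<phi> x + \<phi> y) \<and>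
       (\<forall>x y. \<phi> (x * y) = \<phi> x * \<phi> y) \<and>
       (\<forall>r x. \<phi> (r *\<^sub>R x) = r *\<^sub>R \<phi> x) \<and>
       (\<forall>x. norm (\<phi> x) = norm x) \<and>
       (range \<phi> = \<real> \<or> range \<phi> = UNIV)"
    by (rule exI[of _ "\<lambda>z. z"]) auto
qed

text \<open>
  A Banach space over \<open>\<K>\<close>: completeness comes from the class \<^class>\<open>banach\<close>, whose real scalar
  multiplication is required to be the restriction of \<open>smul\<close>.
\<close>

locale banach_space_over = vector_space smul
  for smul :: "'k::real_or_complex \<Rightarrow> 'a::banach \<Rightarrow> 'a" +
  assumes norm_smul: "norm (smul c x) = norm c * norm x"
    and smul_of_real: "smul (of_real r) x = r *\<^sub>R x"

text \<open>Sequences are indexed from \<open>0\<close>, so that \<open>\<nat>\<close> is the whole type \<^typ>\<open>nat\<close>.\<close>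

definition schauder_basis :: "('k::real_or_complex \<Rightarrow> 'a::banach \<Rightarrow> 'a) \<Rightarrow> (nat \<Rightarrow> 'a) \<Rightarrow> bool" where
  "schauder_basis smul e \<longleftrightarrow> (\<forall>x. \<exists>!a. (\<lambda>n. smul (a n) (e n)) sums x)"

definition semi_normalized :: "(nat \<Rightarrow> 'a::real_normed_vector) \<Rightarrow> bool" where
  "semi_normalized e \<longleftrightarrow> (\<exists>a>0. \<exists>b. \<forall>n. a \<le> norm (e n) \<and> norm (e n) \<le> b)"

text \<open>
  The biorthogonal functionals \<open>e\<^sub>n\<^sup>*\<close>, as the coordinate functionals of the basis. By Banach's
  theorem they are automatically continuous, so continuity is not part of the definition.
\<close>

definition coord :: "('k::real_or_complex \<Rightarrow> 'a::banach \<Rightarrow> 'a) \<Rightarrow> (nat \<Rightarrow> 'a) \<Rightarrow> nat \<Rightarrow> 'a \<Rightarrow> 'k" where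
  "coord smul e n x = (THE a. (\<lambda>k. smul (a k) (e k)) sums x) n"

definition proj :: "('k::real_or_complex \<Rightarrow> 'a::banach \<Rightarrow> 'a) \<Rightarrow> (nat \<Rightarrow> 'a) \<Rightarrow> nat set \<Rightarrow> 'a \<Rightarrow> 'a" where
  "proj smul e A x = (\<Sum>n\<in>A. smul (coord smul e n x) (e n))"

definition supp :: "('k::real_or_complex \<Rightarrow> 'a::banach \<Rightarrow> 'a) \<Rightarrow> (nat \<Rightarrow> 'a) \<Rightarrow> 'a \<Rightarrow> nat set" where
  "supp smul e x = {n. coord smul e n x \<noteq> 0}"

text \<open>
  The supremum is taken over a bounded set, because the coefficients of \<open>x\<close> with respect to a
  semi-normalized basis tend to \<open>0\<close>.
\<close>

definition coord_sup_norm :: "('k::real_or_complex \<Rightarrow> 'a::banach \<Rightarrow> 'a) \<Rightarrow> (nat \<Rightarrow> 'a) \<Rightarrow> 'a \<Rightarrow> real" where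
  "coord_sup_norm smul e x = (SUP n. norm (coord smul e n x))"

definition set_weight :: "(nat set \<Rightarrow> ennreal) \<Rightarrow> bool" where
  "set_weight w \<longleftrightarrow> w {} = 0 \<and> (\<forall>A. A \<noteq> {} \<longrightarrow> 0 < w A)"

definition greedy_set ::
  "('k::real_or_complex \<Rightarrow> 'a::banach \<Rightarrow> 'a) \<Rightarrow> (nat \<Rightarrow> 'a) \<Rightarrow> 'a \<Rightarrow> nat \<Rightarrow> nat set \<Rightarrow> bool" where
  "greedy_set smul e x m \<Lambda> \<longleftrightarrow> finite \<Lambda> \<and> card \<Lambda> = m \<and>
     (\<forall>n\<in>\<Lambda>. \<forall>k. k \<notin> \<Lambda> \<longrightarrow> norm (coord smul e n x) \<ge> norm (coord smul e k x))"

text \<open>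
  The greedy sum attached to a greedy set \<open>\<Lambda>\<close> of \<open>x\<close> is \<open>proj smul e \<Lambda> x\<close>. Orders of greedy
  sets are positive.
\<close>

definition quasi_greedy :: "('k::real_or_complex \<Rightarrow> 'a::banach \<Rightarrow> 'a) \<Rightarrow> (nat \<Rightarrow> 'a) \<Rightarrow> bool" where
  "quasi_greedy smul e \<longleftrightarrow>
     (\<exists>C\<ge>1. \<forall>x. \<forall>m\<ge>1. \<forall>\<Lambda>. greedy_set smul e x m \<Lambda> \<longrightarrow>
        norm (x - proj smul e \<Lambda> x) \<le> C * norm x)"

definition almost_greedy_error ::
  "('k::real_or_complex \<Rightarrow> 'a::banach \<Rightarrow> 'a) \<Rightarrow> (nat \<Rightarrow> 'a) \<Rightarrow> (nat set \<Rightarrow> ennreal) \<Rightarrow> nat set \<Rightarrow> 'a \<Rightarrow> real"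
  where
  "almost_greedy_error smul e w B x =
     Inf {norm (x - proj smul e A x) | A. finite A \<and> w (A - B) \<le> w (B - A)}"

definition almost_greedy ::
  "('k::real_or_complex \<Rightarrow> 'a::banach \<Rightarrow> 'a) \<Rightarrow> (nat \<Rightarrow> 'a) \<Rightarrow> (nat set \<Rightarrow> ennreal) \<Rightarrow> bool" where
  "almost_greedy smul e w \<longleftrightarrow>
     (\<exists>C\<ge>1. \<forall>x. \<forall>m\<ge>1. \<forall>\<Lambda>. greedy_set smul e x m \<Lambda> \<longrightarrow>
        norm (x - proj smul e \<Lambda> x) \<le> C * almost_greedy_error smul e w \<Lambda> x)"

definition is_sign :: "(nat \<Rightarrow> 'k::real_or_complex) \<Rightarrow> bool" where
  "is_sign \<epsilon> \<longleftrightarrow> (\<forall>n. norm (\<epsilon> n) = 1)"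

definition signed_sum ::
  "('k::real_or_complex \<Rightarrow> 'a::banach \<Rightarrow> 'a) \<Rightarrow> (nat \<Rightarrow> 'a) \<Rightarrow> (nat \<Rightarrow> 'k) \<Rightarrow> nat set \<Rightarrow> 'a" where
  "signed_sum smul e \<epsilon> A = (\<Sum>n\<in>A. smul (\<epsilon> n) (e n))"

definition property_A ::
  "('k::real_or_complex \<Rightarrow> 'a::banach \<Rightarrow> 'a) \<Rightarrow> (nat \<Rightarrow> 'a) \<Rightarrow> (nat set \<Rightarrow> ennreal) \<Rightarrow> bool" where
  "property_A smul e w \<longleftrightarrow>
     (\<exists>C\<ge>1. \<forall>A B \<epsilon> \<delta> x.
        finite A \<and> finite B \<and> w A \<le> w B \<and> is_sign \<epsilon> \<and> is_sign \<delta> \<and>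
        coord_sup_norm smul e x \<le> 1 \<and>
        A \<inter> B = {} \<and> A \<inter> supp smul e x = {} \<and> B \<inter> supp smul e x = {} \<longrightarrow>
        norm (x + signed_sum smul e \<epsilon> A) \<le> C * norm (x + signed_sum smul e \<delta> B))"

definition disjoint_democratic :: "(nat \<Rightarrow> 'a::banach) \<Rightarrow> (nat set \<Rightarrow> ennreal) \<Rightarrow> bool" where
  "disjoint_democratic e w \<longleftrightarrow>
     (\<exists>C\<ge>1. \<forall>A B. finite A \<and> finite B \<and> w A \<le> w B \<and> A \<inter> B = {} \<longrightarrow>
        norm (\<Sum>n\<in>A. e n) \<le> C * norm (\<Sum>n\<in>B. e n))"

definition disjoint_superdemocratic ::
  "('k::real_or_complex \<Rightarrow> 'a::banach \<Rightarrow> 'a) \<Rightarrow> (nat \<Rightarrow> 'a) \<Rightarrow> (nat set \<Rightarrow> ennreal) \<Rightarrow> bool" where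
  "disjoint_superdemocratic smul e w \<longleftrightarrow>
     (\<exists>C\<ge>1. \<forall>A B \<epsilon> \<delta>.
        finite A \<and> finite B \<and> w A \<le> w B \<and> A \<inter> B = {} \<and> is_sign \<epsilon> \<and> is_sign \<delta> \<longrightarrow>
        norm (signed_sum smul e \<epsilon> A) \<le> C * norm (signed_sum smul e \<delta> B))"

end

theory Submission
  imports Defs
begin

text \<open>
  For a quasi-greedy basis, writing \<open>\<Sum> b\<^sub>n y\<^sub>n\<close> with \<open>0 \<le> b\<^sub>n \<le> t\<close> as the integral over
  \<open>s \<in> [0,t]\<close> of the sums over the level sets \<open>{n. b\<^sub>n > s}\<close> yields two estimates. First, all sums
  \<open>\<Sum>\<^bsub>n\<in>A\<^esub> c\<^sub>n e\<^sub>n\<close> with \<open>\<bar>c\<^sub>n\<bar> \<le> t\<close> have norm at most a constant times \<open>t \<parallel>1\<^bsub>\<delta>A\<^esub>\<parallel>\<close>, since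
  every subset sum of \<open>1\<^bsub>\<delta>A\<^esub>\<close> is a greedy remainder; thus signs do not matter. Second, if \<open>\<bar>e\<^sub>n\<^sup>*(u)\<bar> \<ge> t\<close>
  on a greedy set \<open>G\<close> of \<open>u\<close>, then \<open>t \<parallel>1\<^bsub>\<delta>G\<^esub>\<parallel>\<close> is at most a constant times \<open>\<parallel>u\<parallel>\<close>, \<open>\<delta>\<close> being the signs
  of the coefficients: the level sets now give greedy remainders of \<open>P\<^sub>G u\<close>.

  For almost greediness, let \<open>\<Lambda>\<close> be a greedy set of \<open>x\<close> and \<open>u = x - P\<^sub>A x\<close>. Then \<open>\<Lambda> - A\<close> is a
  greedy set of \<open>u\<close> and \<open>x - P\<^sub>\<Lambda> x = (u - P\<^bsub>\<Lambda>-A\<^esub> u) + P\<^bsub>A-\<Lambda>\<^esub> x\<close>. The last term has coefficients at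
  most \<open>t = min {\<bar>e\<^sub>n\<^sup>*(x)\<bar> | n \<in> \<Lambda> - A}\<close> and is controlled by the two estimates and democracy.
  Conversely, Property (A) is almost greediness for the vector \<open>x + 1\<^bsub>\<epsilon>A\<^esub> + 1\<^bsub>\<delta>B\<^esub>\<close>.
\<close>

section \<open>Layer-cake estimates and decomposition of scalars\<close>

lemma norm_sum_scaleR_le_level_sets:
  fixes y :: "'i \<Rightarrow> 'a::banach"
  assumes S: "finite S" and b: "\<And>n. n \<in> S \<Longrightarrow> 0 \<le> b n \<and> b n \<le> t" and t: "0 \<le> t"
    and M: "\<And>s. 0 \<le> s \<Longrightarrow> norm (\<Sum>n\<in>{n\<in>S. s < b n}. y n) \<le> M"
  shows "norm (\<Sum>n\<in>S. b n *\<^sub>R y n) \<le> t * M"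
proof -
  have M0: "0 \<le> M" using M[of 0] by (meson norm_ge_zero order_trans order_refl)
  have one: "((\<lambda>s. if s < b n then y n else 0) has_integral (b n *\<^sub>R y n)) (cbox 0 t)"
    if n: "n \<in> S" for n
  proof -
    have "((\<lambda>s. y n) has_integral (b n *\<^sub>R y n)) {0..b n}"
      using has_integral_const_real[of "y n" 0 "b n"] b[OF n] by simp
    \<comment> \<open>On \<open>{0..b n}\<close> the step function differs from the constant
      \<open>y n\<close> only at the point \<open>s = b n\<close>.\<close>
    then have "((\<lambda>s. if s < b n then y n else 0) has_integral (b n *\<^sub>R y n)) {0..b n}"
      by (rule has_integral_spike_finite[where S="{b n}", rotated 2]) auto
    moreover have "((\<lambda>s. if s < b n then y n else 0) has_integral 0) {b n..t}"
      by (rule has_integral_is_0) auto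
    ultimately have "((\<lambda>s. if s < b n then y n else 0) has_integral (b n *\<^sub>R y n + 0)) {0..t}"
      using b[OF n] by (intro has_integral_combine[where c="b n"]) auto
    then show ?thesis by simp
  qed
  have "((\<lambda>s. \<Sum>n\<in>S. if s < b n then y n else 0) has_integral (\<Sum>n\<in>S. b n *\<^sub>R y n)) (cbox 0 t)"
    by (rule has_integral_sum[OF S one])
  then have "norm (\<Sum>n\<in>S. b n *\<^sub>R y n) \<le> M * measure lborel (cbox 0 t)"
  proof (rule has_integral_bound[OF M0])
    show "norm (\<Sum>n\<in>S. if s < b n then y n else 0) \<le> M" if "s \<in> cbox 0 t" for s
      using M[of s] that S by (simp add: sum.inter_filter)
  qed
  then show ?thesis using t by (simp add: mult.commute)
qed

text \<open>Splitting \<open>b\<close> into positive and negative parts costs the factor 2; every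
  level set of either part is a subset of \<open>S\<close>.\<close>

lemma norm_sum_scaleR_le_subset_sums:
  fixes y :: "'i \<Rightarrow> 'a::banach"
  assumes S: "finite S" and b: "\<And>n. n \<in> S \<Longrightarrow> \<bar>b n\<bar> \<le> t" and t: "0 \<le> t"
    and M: "\<And>B. B \<subseteq> S \<Longrightarrow> norm (\<Sum>n\<in>B. y n) \<le> M"
  shows "norm (\<Sum>n\<in>S. b n *\<^sub>R y n) \<le> 2 * t * M"
proof -
  have pos: "norm (\<Sum>n\<in>S. max (b n) 0 *\<^sub>R y n) \<le> t * M"
    using b t by (intro norm_sum_scaleR_le_level_sets S M) (auto simp: abs_le_iff)
  have neg: "norm (\<Sum>n\<in>S. max (- b n) 0 *\<^sub>R y n) \<le> t * M"
    using b t by (intro norm_sum_scaleR_le_level_sets S M) (auto simp: abs_le_iff)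
  have "(\<Sum>n\<in>S. b n *\<^sub>R y n) = (\<Sum>n\<in>S. max (b n) 0 *\<^sub>R y n) - (\<Sum>n\<in>S. max (- b n) 0 *\<^sub>R y n)"
    unfolding sum_subtractf[symmetric] scaleR_diff_left[symmetric]
    by (intro sum.cong) (auto simp: max_def)
  then show ?thesis
    using norm_triangle_ineq4[of "\<Sum>n\<in>S. max (b n) 0 *\<^sub>R y n" "\<Sum>n\<in>S. max (- b n) 0 *\<^sub>R y n"] pos neg
    by simp
qed

text \<open>Treats both scalar fields at once: \<open>j\<close> corresponds to the imaginary unit in
  the complex case and is 0 in the real case, so a family of scalars reduces to two real families of
  no larger modulus.\<close>

lemma real_or_complex_decomposition:
  "\<exists>j :: 'k::real_or_complex. norm j \<le> 1 \<and>
    (\<forall>c. \<exists>a b. \<bar>a\<bar> \<le> norm c \<and> \<bar>b\<bar> \<le> norm c \<and> c = of_real a + of_real b * j)"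
proof -
  obtain \<phi> :: "'k \<Rightarrow> complex" where add: "\<And>x y. \<phi> (x + y) = \<phi> x + \<phi> y"
    and mult: "\<And>x y. \<phi> (x * y) = \<phi> x * \<phi> y"
    and sc: "\<And>r x. \<phi> (r *\<^sub>R x) = r *\<^sub>R \<phi> x" and nm: "\<And>x. norm (\<phi> x) = norm x"
    and rng: "range \<phi> = \<real> \<or> range \<phi> = UNIV"
    using isometric_real_or_complex by blast
  \<comment> \<open>A nonzero idempotent of a field is 1, and \<open>\<phi> 1\<close> is nonzero
    because \<open>\<phi>\<close> preserves norms.\<close>
  have "\<phi> 1 * \<phi> 1 = \<phi> 1" "\<phi> 1 \<noteq> 0"
    using mult[of 1 1] nm[of 1] by auto
  then have one: "\<phi> 1 = 1" by simp
  have of_real: "\<phi> (of_real r) = of_real r" for r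
    using sc[of r 1] one by (simp add: of_real_def)
  have diff: "\<phi> (x - y) = \<phi> x - \<phi> y" for x y
    using add[of "x - y" y] by simp
  \<comment> \<open>Injectivity allows the decomposition to be checked on the complex side.\<close>
  have inj: "x = y" if "\<phi> x = \<phi> y" for x y
    using nm[of "x - y"] that by (simp add: diff)
  show ?thesis
  proof (cases "range \<phi> = UNIV")
    case True
    then obtain j :: 'k where i: "\<phi> j = \<i>" by (metis surjD)
    show ?thesis
    proof (rule exI[of _ j], intro conjI allI)
      show "norm j \<le> 1" using nm[of j] i by simp
      show "\<exists>a b. \<bar>a\<bar> \<le> norm c \<and> \<bar>b\<bar> \<le> norm c \<and> c = of_real a + of_real b * j" for c
        using abs_Re_le_cmod[of "\<phi> c"] abs_Im_le_cmod[of "\<phi> c"]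
        by (intro exI[of _ "Re (\<phi> c)"] exI[of _ "Im (\<phi> c)"])
          (auto simp: nm add mult of_real i complex_eq_iff intro!: inj)
    qed
  next
    case False
    then have real: "\<phi> c \<in> \<real>" for c using rng by blast
    show ?thesis
    proof (rule exI[of _ 0], intro conjI allI)
      show "\<exists>a b. \<bar>a\<bar> \<le> norm c \<and> \<bar>b\<bar> \<le> norm c \<and> c = of_real a + of_real b * 0" for c :: 'k
        using abs_Re_le_cmod[of "\<phi> c"] real[of c]
        by (intro exI[of _ "Re (\<phi> c)"] exI[of _ 0])
          (auto simp: nm of_real intro!: inj)
    qed simp
  qed
qed

section \<open>Curried rules for Property (A) and the democracy properties\<close>

lemma property_AI:
  assumes "1 \<le> C"
    and "\<And>A B \<epsilon> \<delta> x. finite A \<Longrightarrow> finite B \<Longrightarrow> w A \<le> w B \<Longrightarrow>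
      is_sign \<epsilon> \<Longrightarrow> is_sign \<delta> \<Longrightarrow> coord_sup_norm smul e x \<le> 1 \<Longrightarrow> A \<inter> B = {} \<Longrightarrow>
      A \<inter> supp smul e x = {} \<Longrightarrow> B \<inter> supp smul e x = {} \<Longrightarrow>
      norm (x + signed_sum smul e \<epsilon> A) \<le> C * norm (x + signed_sum smul e \<delta> B)"
  shows "property_A smul e w"
  unfolding property_A_def by (intro exI[of _ C] conjI allI impI assms) simp_all

lemma property_AE:
  assumes "property_A smul e w"
  obtains C where "1 \<le> C"
    and "\<And>A B \<epsilon> \<delta> x. finite A \<Longrightarrow> finite B \<Longrightarrow> w A \<le> w B \<Longrightarrow>
      is_sign \<epsilon> \<Longrightarrow> is_sign \<delta> \<Longrightarrow> coord_sup_norm smul e x \<le> 1 \<Longrightarrow> A \<inter> B = {} \<Longrightarrow>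
      A \<inter> supp smul e x = {} \<Longrightarrow> B \<inter> supp smul e x = {} \<Longrightarrow>
      norm (x + signed_sum smul e \<epsilon> A) \<le> C * norm (x + signed_sum smul e \<delta> B)"
  using assms unfolding property_A_def by (elim exE conjE) (rule that, assumption, simp)

lemma disjoint_superdemocraticI:
  assumes "1 \<le> C"
    and "\<And>A B \<epsilon> \<delta>. finite A \<Longrightarrow> finite B \<Longrightarrow> w A \<le> w B \<Longrightarrow> A \<inter> B = {} \<Longrightarrow>
      is_sign \<epsilon> \<Longrightarrow> is_sign \<delta> \<Longrightarrow> norm (signed_sum smul e \<epsilon> A) \<le> C * norm (signed_sum smul e \<delta> B)"
  shows "disjoint_superdemocratic smul e w"
  unfolding disjoint_superdemocratic_def by (intro exI[of _ C] conjI allI impI assms) simp_all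

lemma disjoint_superdemocraticE:
  assumes "disjoint_superdemocratic smul e w"
  obtains C where "1 \<le> C"
    and "\<And>A B \<epsilon> \<delta>. finite A \<Longrightarrow> finite B \<Longrightarrow> w A \<le> w B \<Longrightarrow> A \<inter> B = {} \<Longrightarrow>
      is_sign \<epsilon> \<Longrightarrow> is_sign \<delta> \<Longrightarrow> norm (signed_sum smul e \<epsilon> A) \<le> C * norm (signed_sum smul e \<delta> B)"
  using assms unfolding disjoint_superdemocratic_def by (elim exE conjE) (rule that, assumption, simp)

lemma disjoint_democraticI:
  assumes "1 \<le> C"
    and "\<And>A B. finite A \<Longrightarrow> finite B \<Longrightarrow> w A \<le> w B \<Longrightarrow> A \<inter> B = {} \<Longrightarrow>
      norm (\<Sum>n\<in>A. e n) \<le> C * norm (\<Sum>n\<in>B. e n)"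
  shows "disjoint_democratic e w"
  unfolding disjoint_democratic_def by (intro exI[of _ C] conjI allI impI assms) simp_all

lemma disjoint_democraticE:
  assumes "disjoint_democratic e w"
  obtains C where "1 \<le> C"
    and "\<And>A B. finite A \<Longrightarrow> finite B \<Longrightarrow> w A \<le> w B \<Longrightarrow> A \<inter> B = {} \<Longrightarrow>
      norm (\<Sum>n\<in>A. e n) \<le> C * norm (\<Sum>n\<in>B. e n)"
  using assms unfolding disjoint_democratic_def by (elim exE conjE) (rule that, assumption, simp)

section \<open>Coordinates with respect to a Schauder basis\<close>

locale schauder_space = banach_space_over smul
  for smul :: "'k::real_or_complex \<Rightarrow> 'a::banach \<Rightarrow> 'a" +
  fixes e :: "nat \<Rightarrow> 'a"
  assumes schauder: "schauder_basis smul e"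
begin

abbreviation "coef \<equiv> coord smul e"
abbreviation "P \<equiv> proj smul e"
abbreviation "sgsum \<equiv> signed_sum smul e"

lemma coord_sums: "(\<lambda>n. smul (coef n x) (e n)) sums x"
  using schauder theI'[of "\<lambda>a. (\<lambda>k. smul (a k) (e k)) sums x"]
  by (simp add: schauder_basis_def coord_def)

lemma coord_unique: "coef n x = a n" if "(\<lambda>n. smul (a n) (e n)) sums x"
proof -
  have "\<exists>!a. (\<lambda>k. smul (a k) (e k)) sums x" using schauder by (simp add: schauder_basis_def)
  from the1_equality[where P="\<lambda>a. (\<lambda>k. smul (a k) (e k)) sums x", OF this that] show ?thesis by (simp add: coord_def)
qed

lemma coord_add: "coef n (x + y) = coef n x + coef n y"
  by (rule coord_unique) (use sums_add[OF coord_sums coord_sums] in \<open>simp add: scale_left_distrib\<close>)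

lemma coord_diff: "coef n (x - y) = coef n x - coef n y"
  using coord_add[of n "x - y" y] by simp

lemma coord_sum:
  assumes "finite A"
  shows "coef n (\<Sum>k\<in>A. smul (c k) (e k)) = (if n \<in> A then c n else 0)"
proof -
  \<comment> \<open>Extending the coefficients by zero makes the finite sum a basis expansion, to
    which uniqueness applies.\<close>
  have "(\<lambda>k. smul (if k \<in> A then c k else 0) (e k)) sums
    (\<Sum>k\<in>A. smul (if k \<in> A then c k else 0) (e k))"
    using assms by (intro sums_finite) auto
  then show ?thesis by (intro coord_unique) (simp cong: sum.cong)
qed

lemma coord_proj: "finite A \<Longrightarrow> coef n (P A x) = (if n \<in> A then coef n x else 0)"
  unfolding proj_def by (rule coord_sum)

lemma coord_signed_sum: "finite A \<Longrightarrow> coef n (sgsum \<epsilon> A) = (if n \<in> A then \<epsilon> n else 0)"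
  unfolding signed_sum_def by (rule coord_sum)

lemma coord_0 [simp]: "coef n 0 = 0"
  using coord_diff[of n 0 0] by simp

text \<open>A real supremum dominates its family only if the family is bounded. The terms of the
  convergent expansion are bounded, and the lower bound on \<open>norm (e n)\<close> passes this on
  to the coefficients.\<close>

lemma norm_coord_le_sup:
  assumes "semi_normalized e"
  shows "norm (coef n x) \<le> coord_sup_norm smul e x"
  unfolding coord_sup_norm_def
proof (rule cSUP_upper)
  obtain a where a: "0 < a" "\<And>n. a \<le> norm (e n)"
    using assms unfolding semi_normalized_def by blast
  obtain K where K: "\<And>n. norm (smul (coef n x) (e n)) \<le> K"
    using summable_imp_Bseq[OF sums_summable[OF coord_sums[of x]]] unfolding Bseq_def by blast
  have "norm (coef n x) \<le> K / a" for n
  proof -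
    have "norm (coef n x) * a \<le> norm (coef n x) * norm (e n)"
      by (intro mult_left_mono a) simp
    also have "\<dots> \<le> K" using K[of n] by (simp add: norm_smul)
    finally show ?thesis using a by (simp add: field_simps)
  qed
  then show "bdd_above (range (\<lambda>n. norm (coef n x)))" by (rule bdd_aboveI2)
qed simp

section \<open>Implications that do not start from quasi-greediness\<close>

lemma quasi_greedy_if_almost_greedy:
  assumes ag: "almost_greedy smul e w" and w: "set_weight w"
  shows "quasi_greedy smul e"
proof -
  obtain C where C: "1 \<le> C" and le: "\<And>x m \<Lambda>. 1 \<le> m \<Longrightarrow> greedy_set smul e x m \<Lambda> \<Longrightarrow>
      norm (x - P \<Lambda> x) \<le> C * almost_greedy_error smul e w \<Lambda> x"
    using ag unfolding almost_greedy_def by blast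
  \<comment> \<open>The empty set is an admissible competitor for every \<open>\<Lambda>\<close>,
    because \<open>w {} = 0\<close>.\<close>
  have "almost_greedy_error smul e w \<Lambda> x \<le> norm x" for \<Lambda> x
    unfolding almost_greedy_error_def using w
    by (intro cInf_lower bdd_belowI[of _ 0])
      (auto simp: set_weight_def proj_def intro!: exI[of _ "{}"])
  then have "C * almost_greedy_error smul e w \<Lambda> x \<le> C * norm x" for \<Lambda> x
    using C by simp
  then have "norm (x - P \<Lambda> x) \<le> C * norm x" if "1 \<le> m" "greedy_set smul e x m \<Lambda>" for x m \<Lambda>
    using le[OF that] by (rule order_trans[rotated])
  with C show ?thesis unfolding quasi_greedy_def by (intro exI[of _ C] conjI allI impI) simp_all
qed

lemma property_A_if_almost_greedy:
  assumes ag: "almost_greedy smul e w" and w: "set_weight w" and sn: "semi_normalized e"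
  shows "property_A smul e w"
proof -
  obtain C where C: "1 \<le> C" and le: "\<And>x m \<Lambda>. 1 \<le> m \<Longrightarrow> greedy_set smul e x m \<Lambda> \<Longrightarrow>
      norm (x - P \<Lambda> x) \<le> C * almost_greedy_error smul e w \<Lambda> x"
    using ag unfolding almost_greedy_def by blast
  have bound: "norm (x + sgsum \<epsilon> A) \<le> C * norm (x + sgsum \<delta> B)"
    if A: "finite A" and B: "finite B" and AB: "w A \<le> w B" and \<epsilon>: "is_sign \<epsilon>" and \<delta>: "is_sign \<delta>"
      and x: "coord_sup_norm smul e x \<le> 1" and dis: "A \<inter> B = {}" "A \<inter> supp smul e x = {}"
        "B \<inter> supp smul e x = {}" for A B \<epsilon> \<delta> x
  proof (cases "B = {}")
    case True
    \<comment> \<open>A weight vanishes only on the empty set.\<close>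
    then have "A = {}" using w AB unfolding set_weight_def by (metis le_zero_eq less_irrefl)
    then show ?thesis using True C by (simp add: signed_sum_def mult_le_cancel_right1)
  next
    case False
    \<comment> \<open>Removing \<open>B\<close> from \<open>y\<close> leaves
      \<open>x + sgsum \<epsilon> A\<close>, and removing \<open>A\<close> leaves
      \<open>x + sgsum \<delta> B\<close>: the two sides to be compared.\<close>
    define y where "y = x + sgsum \<epsilon> A + sgsum \<delta> B"
    have x1: "norm (coef n x) \<le> 1" for n using norm_coord_le_sup[OF sn, of n x] x by linarith
    have x0: "coef n x = 0" if "n \<in> A \<union> B" for n using that dis by (auto simp: supp_def)
    have coef_y: "coef n y = coef n x + (if n \<in> A then \<epsilon> n else 0) + (if n \<in> B then \<delta> n else 0)" for n
      unfolding y_def by (simp add: coord_add coord_signed_sum A B)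
    have coef_A: "coef n y = \<epsilon> n" if "n \<in> A" for n using that dis x0 by (auto simp: coef_y)
    have coef_B: "coef n y = \<delta> n" if "n \<in> B" for n using that dis x0 by (auto simp: coef_y)
    have le1: "norm (coef n y) \<le> 1" for n
      using \<epsilon> \<delta> x1[of n] coef_A[of n] coef_B[of n] coef_y[of n]
      by (cases "n \<in> A"; cases "n \<in> B") (auto simp: is_sign_def)
    have "greedy_set smul e y (card B) B"
      using \<delta> le1 coef_B B by (auto simp: greedy_set_def is_sign_def)
    then have *: "norm (y - P B y) \<le> C * almost_greedy_error smul e w B y"
      using le[of "card B" y B] False B by (simp add: Suc_le_eq card_gt_0_iff)
    have PB: "P B y = sgsum \<delta> B" and PA: "P A y = sgsum \<epsilon> A"
      unfolding proj_def signed_sum_def by (simp_all add: coef_A coef_B)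
    \<comment> \<open>By disjointness \<open>A - B\<close> and \<open>B - A\<close> are
      \<open>A\<close> and \<open>B\<close>, so \<open>w A \<le> w B\<close> says precisely that
      \<open>A\<close> is admissible.\<close>
    have "almost_greedy_error smul e w B y \<le> norm (y - P A y)"
      unfolding almost_greedy_error_def using A AB dis
      by (intro cInf_lower bdd_belowI[of _ 0]) (auto intro!: exI[of _ A] simp: Diff_triv Int_commute)
    also have "y - P A y = x + sgsum \<delta> B" unfolding PA by (simp add: y_def)
    finally have "C * almost_greedy_error smul e w B y \<le> C * norm (x + sgsum \<delta> B)"
      using C by simp
    with * show ?thesis unfolding PB by (simp add: y_def)
  qed
  show ?thesis by (rule property_AI[OF C]) (rule bound)
qed

text \<open>Specialise Property (A) to \<open>x = 0\<close>.\<close>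

lemma disjoint_superdemocratic_if_property_A:
  assumes "property_A smul e w"
  shows "disjoint_superdemocratic smul e w"
proof -
  obtain C where C: "1 \<le> C" and le: "\<And>A B \<epsilon> \<delta> x. finite A \<Longrightarrow> finite B \<Longrightarrow> w A \<le> w B \<Longrightarrow>
      is_sign \<epsilon> \<Longrightarrow> is_sign \<delta> \<Longrightarrow> coord_sup_norm smul e x \<le> 1 \<Longrightarrow> A \<inter> B = {} \<Longrightarrow>
      A \<inter> supp smul e x = {} \<Longrightarrow> B \<inter> supp smul e x = {} \<Longrightarrow>
      norm (x + sgsum \<epsilon> A) \<le> C * norm (x + sgsum \<delta> B)"
    using assms(1) by (rule property_AE) (rule that, assumption, simp)
  have "coord_sup_norm smul e 0 \<le> 1" "supp smul e 0 = {}"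
    by (auto simp: coord_sup_norm_def supp_def)
  then show ?thesis
    using le[where x=0] by (intro disjoint_superdemocraticI[OF C]) simp
qed

lemma disjoint_democratic_if_superdemocratic:
  assumes "disjoint_superdemocratic smul e w"
  shows "disjoint_democratic e w"
proof -
  obtain C where C: "1 \<le> C" and le: "\<And>A B \<epsilon> \<delta>. finite A \<Longrightarrow> finite B \<Longrightarrow> w A \<le> w B \<Longrightarrow>
      A \<inter> B = {} \<Longrightarrow> is_sign \<epsilon> \<Longrightarrow> is_sign \<delta> \<Longrightarrow> norm (sgsum \<epsilon> A) \<le> C * norm (sgsum \<delta> B)"
    using assms(1) by (rule disjoint_superdemocraticE) (rule that, assumption, simp)
  have "is_sign (\<lambda>_. 1 :: 'k)" by (simp add: is_sign_def)
  moreover have "sgsum (\<lambda>_. 1) A = (\<Sum>n\<in>A. e n)" for A by (simp add: signed_sum_def)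
  ultimately show ?thesis
    using le[of _ _ "\<lambda>_. 1" "\<lambda>_. 1"] by (intro disjoint_democraticI[OF C]) simp
qed

end

section \<open>Estimates with a fixed quasi-greedy constant\<close>

locale quasi_greedy_space = schauder_space smul e
  for smul :: "'k::real_or_complex \<Rightarrow> 'a::banach \<Rightarrow> 'a" and e +
  fixes C :: real
  assumes C_ge_1: "1 \<le> C"
    and norm_greedy_remainder: "greedy_set smul e x m \<Lambda> \<Longrightarrow> norm (x - P \<Lambda> x) \<le> C * norm x"
begin

lemma C_nonneg: "0 \<le> C" using C_ge_1 by simp

lemma norm_greedy_sum:
  assumes "greedy_set smul e x m \<Lambda>"
  shows "norm (P \<Lambda> x) \<le> (1 + C) * norm x"
proof -
  have "norm (P \<Lambda> x) \<le> norm x + norm (x - P \<Lambda> x)"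
    using norm_triangle_ineq4[of x "x - P \<Lambda> x"] by simp
  then show ?thesis using norm_greedy_remainder[OF assms] by (simp add: algebra_simps)
qed

text \<open>The nonzero coefficients all have modulus 1, so \<open>A - B\<close> is a greedy set,
  with remainder \<open>sgsum \<delta> B\<close>.\<close>

lemma norm_signed_sum_subset:
  assumes A: "finite A" and BA: "B \<subseteq> A" and \<delta>: "is_sign \<delta>"
  shows "norm (sgsum \<delta> B) \<le> C * norm (sgsum \<delta> A)"
proof -
  have "greedy_set smul e (sgsum \<delta> A) (card (A - B)) (A - B)"
    using A \<delta> by (auto simp: greedy_set_def coord_signed_sum is_sign_def)
  moreover have "sgsum \<delta> A - P (A - B) (sgsum \<delta> A) = sgsum \<delta> B"
  proof -
    have "P (A - B) (sgsum \<delta> A) = sgsum \<delta> (A - B)"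
      unfolding proj_def using A by (simp add: coord_signed_sum) (simp add: signed_sum_def)
    then show ?thesis
      using sum_diff[OF A BA, of "\<lambda>n. smul (\<delta> n) (e n)"] by (simp add: signed_sum_def)
  qed
  ultimately show ?thesis using norm_greedy_remainder by metis
qed

text \<open>The factor 4 comes from two real components, each split into two signs; \<open>C\<close>
  bounds the subset sums of \<open>sgsum \<delta> A\<close>.\<close>

lemma norm_sum_le_signed_sum:
  assumes A: "finite A" and \<delta>: "is_sign \<delta>" and t: "0 \<le> t"
    and c: "\<And>n. n \<in> A \<Longrightarrow> norm (c n) \<le> t"
  shows "norm (\<Sum>n\<in>A. smul (c n) (e n)) \<le> 4 * C * (t * norm (sgsum \<delta> A))"
proof -
  obtain j :: 'k where i: "norm j \<le> 1" and
    dec: "\<And>c. \<exists>a b. \<bar>a\<bar> \<le> norm c \<and> \<bar>b\<bar> \<le> norm c \<and> c = of_real a + of_real b * j"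
    using real_or_complex_decomposition by blast
  \<comment> \<open>Dividing by \<open>\<delta> n\<close> keeps the modulus and moves the sign into
    the vectors \<open>y n\<close>, whose subset sums are under control.\<close>
  have "\<forall>n. \<exists>a b. \<bar>a\<bar> \<le> norm (c n / \<delta> n) \<and> \<bar>b\<bar> \<le> norm (c n / \<delta> n) \<and> c n / \<delta> n = of_real a + of_real b * j"
    using dec by blast
  then obtain a b where ab: "\<And>n. \<bar>a n\<bar> \<le> norm (c n / \<delta> n)" "\<And>n. \<bar>b n\<bar> \<le> norm (c n / \<delta> n)"
    "\<And>n. c n / \<delta> n = of_real (a n) + of_real (b n) * j"
    by metis
  define y where "y n = smul (\<delta> n) (e n)" for n
  define M where "M = C * norm (sgsum \<delta> A)"
  have \<delta>1: "norm (\<delta> n) = 1" for n using \<delta> by (simp add: is_sign_def)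
  then have \<delta>0: "\<delta> n \<noteq> 0" for n by (metis norm_zero zero_neq_one)
  have M: "norm (\<Sum>n\<in>B. y n) \<le> M" if "B \<subseteq> A" for B
    using norm_signed_sum_subset[OF A that \<delta>] by (simp add: signed_sum_def y_def M_def)
  have "\<bar>a n\<bar> \<le> t" "\<bar>b n\<bar> \<le> t" if "n \<in> A" for n
    using ab(1,2)[of n] c[OF that] by (auto simp: norm_divide \<delta>1)
  then have re: "norm (\<Sum>n\<in>A. a n *\<^sub>R y n) \<le> 2 * t * M"
    and im: "norm (\<Sum>n\<in>A. b n *\<^sub>R y n) \<le> 2 * t * M"
    by (intro norm_sum_scaleR_le_subset_sums A t M; simp)+
  have "smul (c n) (e n) = a n *\<^sub>R y n + smul j (b n *\<^sub>R y n)" for n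
  proof -
    have "c n = of_real (a n) * \<delta> n + j * (of_real (b n) * \<delta> n)"
      using ab(3)[of n] \<delta>0[of n] by (simp add: field_simps)
    then show ?thesis by (simp add: y_def scale_left_distrib flip: smul_of_real)
  qed
  then have "(\<Sum>n\<in>A. smul (c n) (e n)) = (\<Sum>n\<in>A. a n *\<^sub>R y n) + smul j (\<Sum>n\<in>A. b n *\<^sub>R y n)"
    by (simp add: sum.distrib scale_sum_right)
  then have "norm (\<Sum>n\<in>A. smul (c n) (e n)) \<le>
      norm (\<Sum>n\<in>A. a n *\<^sub>R y n) + norm (smul j (\<Sum>n\<in>A. b n *\<^sub>R y n))"
    by (simp add: norm_triangle_ineq)
  also have "norm (smul j (\<Sum>n\<in>A. b n *\<^sub>R y n)) \<le> norm (\<Sum>n\<in>A. b n *\<^sub>R y n)"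
    using i by (simp add: norm_smul mult_left_le_one_le)
  finally show ?thesis using re im by (simp add: M_def algebra_simps)
qed

text \<open>Scaling each coefficient by \<open>b n = t / norm (coef n u)\<close>, which lies in
  \<open>[0,1]\<close>, turns \<open>P G u\<close> into \<open>t\<close> times a signed sum. One
  factor \<open>C\<close> bounds the level sums by \<open>norm (P G u)\<close>; the factor
  \<open>1 + C\<close> bounds the latter by \<open>norm u\<close>.\<close>

lemma truncation_le_norm:
  assumes G: "greedy_set smul e u m G" and t: "0 \<le> t" "\<And>n. n \<in> G \<Longrightarrow> t \<le> norm (coef n u)"
  obtains \<delta> where "is_sign \<delta>" "t * norm (sgsum \<delta> G) \<le> C * (1 + C) * norm u"
proof -
  \<comment> \<open>The value 1 at zero coefficients is needed because \<open>sgn 0\<close> is not a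
    sign.\<close>
  define \<delta> where "\<delta> n = (if coef n u = 0 then 1 else sgn (coef n u))" for n
  have sign: "is_sign \<delta>" by (simp add: is_sign_def \<delta>_def norm_sgn)
  have fin: "finite G" using G by (simp add: greedy_set_def)
  have "t * norm (sgsum \<delta> G) \<le> C * (1 + C) * norm u"
  proof (cases "t = 0")
    case True
    then show ?thesis using C_nonneg by simp
  next
    case False
    then have t0: "0 < t" using t by simp
    then have pos: "0 < norm (coef n u)" if "n \<in> G" for n using t(2)[OF that] by linarith
    \<comment> \<open>Restricting to \<open>G\<close> first ensures that removing \<open>H\<close>
      below leaves only the level sum, without the part of \<open>u\<close> outside
      \<open>G\<close>.\<close>
    define v where "v = P G u"
    define b where "b n = t / norm (coef n u)" for n
    have cv: "coef n v = (if n \<in> G then coef n u else 0)" for n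
      unfolding v_def by (rule coord_proj[OF fin])
    have level: "norm (\<Sum>n\<in>{n\<in>G. s < b n}. smul (coef n u) (e n)) \<le> C * norm v" if "0 \<le> s" for s
    proof -
      \<comment> \<open>Small \<open>b n\<close> means a large coefficient, so the complement of a
        level set in \<open>G\<close> is greedy for \<open>v\<close>.\<close>
      define H where "H = {n\<in>G. b n \<le> s}"
      have "norm (coef k v) \<le> norm (coef n v)" if n: "n \<in> H" and k: "k \<notin> H" for n k
      proof (cases "k \<in> G")
        case True
        with n k have "n \<in> G" "b n < b k" by (auto simp: H_def)
        with True pos[of n] pos[of k] t0 show ?thesis
          by (simp add: cv b_def field_simps)
      qed (simp add: cv)
      then have "greedy_set smul e v (card H) H"
        using fin by (auto simp: greedy_set_def H_def)
      moreover have "v - P H v = (\<Sum>n\<in>{n\<in>G. s < b n}. smul (coef n u) (e n))"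
      proof -
        have "P H v = (\<Sum>n\<in>H. smul (coef n u) (e n))"
          unfolding proj_def by (intro sum.cong) (auto simp: cv H_def)
        moreover have "v = (\<Sum>n\<in>G. smul (coef n u) (e n))" by (simp add: v_def proj_def)
        moreover have "{n\<in>G. s < b n} = G - H" by (auto simp: H_def)
        ultimately show ?thesis using fin by (simp add: sum_diff H_def)
      qed
      ultimately show ?thesis using norm_greedy_remainder by metis
    qed
    have "0 \<le> b n \<and> b n \<le> 1" if "n \<in> G" for n
      using pos[OF that] t(2)[OF that] t0 by (simp add: b_def)
    then have "norm (\<Sum>n\<in>G. b n *\<^sub>R smul (coef n u) (e n)) \<le> 1 * (C * norm v)"
      by (intro norm_sum_scaleR_le_level_sets fin level) auto
    also have "(\<Sum>n\<in>G. b n *\<^sub>R smul (coef n u) (e n)) = t *\<^sub>R sgsum \<delta> G"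
      unfolding signed_sum_def scaleR_sum_right
    proof (intro sum.cong refl)
      fix n assume "n \<in> G"
      with pos[of n] have "of_real (b n) * coef n u = of_real t * \<delta> n"
        by (simp add: b_def \<delta>_def sgn_div_norm scaleR_conv_of_real field_simps)
      then show "b n *\<^sub>R smul (coef n u) (e n) = t *\<^sub>R smul (\<delta> n) (e n)"
        by (simp flip: smul_of_real)
    qed
    finally have "t * norm (sgsum \<delta> G) \<le> C * norm v" using t0 by simp
    also have "\<dots> \<le> C * ((1 + C) * norm u)"
      unfolding v_def by (intro mult_left_mono norm_greedy_sum[OF G] C_nonneg)
    finally show ?thesis by (simp add: mult.assoc)
  qed
  with sign show thesis by (rule that)
qed

text \<open>Pass from \<open>\<epsilon>\<close> to constant sign on \<open>A\<close>, use democracy,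
  then pass to \<open>\<delta>\<close> on \<open>B\<close>; each change of signs costs
  \<open>4 * C\<close>.\<close>

lemma disjoint_superdemocratic_if_democratic:
  assumes "disjoint_democratic e w"
  shows "disjoint_superdemocratic smul e w"
proof -
  obtain D where D: "1 \<le> D" and le: "\<And>A B. finite A \<Longrightarrow> finite B \<Longrightarrow> w A \<le> w B \<Longrightarrow>
      A \<inter> B = {} \<Longrightarrow> norm (\<Sum>n\<in>A. e n) \<le> D * norm (\<Sum>n\<in>B. e n)"
    using assms(1) by (rule disjoint_democraticE) (rule that, assumption, simp)
  have sign1: "is_sign (\<lambda>_. 1 :: 'k)" by (simp add: is_sign_def)
  have sum1: "sgsum (\<lambda>_. 1) A = (\<Sum>n\<in>A. e n)" for A by (simp add: signed_sum_def)
  have signs: "norm (sgsum \<epsilon> A) \<le> 4 * C * norm (sgsum \<delta> A)"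
    if "finite A" "is_sign \<epsilon>" "is_sign \<delta>" for A \<epsilon> \<delta>
    using norm_sum_le_signed_sum[of A \<delta> 1 \<epsilon>] that
    by (simp add: is_sign_def signed_sum_def[of _ _ \<epsilon>])
  have bound: "norm (sgsum \<epsilon> A) \<le> 16 * C\<^sup>2 * D * norm (sgsum \<delta> B)"
    if A: "finite A" and B: "finite B" and AB: "w A \<le> w B" "A \<inter> B = {}"
      and \<epsilon>: "is_sign \<epsilon>" and \<delta>: "is_sign \<delta>" for A B \<epsilon> \<delta>
  proof -
    have "norm (sgsum \<epsilon> A) \<le> 4 * C * norm (\<Sum>n\<in>A. e n)"
      using signs[OF A \<epsilon> sign1] by (simp add: sum1)
    also have "\<dots> \<le> 4 * C * (D * norm (\<Sum>n\<in>B. e n))"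
      using le[OF A B AB] C_ge_1 by (intro mult_left_mono) auto
    also have "\<dots> \<le> 4 * C * (D * (4 * C * norm (sgsum \<delta> B)))"
      using signs[OF B sign1 \<delta>] C_ge_1 D by (intro mult_left_mono) (auto simp: sum1)
    finally show ?thesis by (simp add: power2_eq_square mult_ac)
  qed
  have one: "1 \<le> 16 * C\<^sup>2 * D"
    using mult_mono[of 1 "16 * C\<^sup>2" 1 D] D one_le_power[OF C_ge_1, of 2] by simp
  show ?thesis by (rule disjoint_superdemocraticI[OF one]) (rule bound)
qed

text \<open>\<open>B\<close> is a greedy set of \<open>x + sgsum \<delta> B\<close>, so
  \<open>x\<close> is its greedy remainder and \<open>sgsum \<delta> B\<close> its greedy sum;
  superdemocracy bounds \<open>sgsum \<epsilon> A\<close> by the latter.\<close>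

lemma property_A_if_superdemocratic:
  assumes "disjoint_superdemocratic smul e w" and sn: "semi_normalized e"
  shows "property_A smul e w"
proof -
  obtain D where D: "1 \<le> D" and le: "\<And>A B \<epsilon> \<delta>. finite A \<Longrightarrow> finite B \<Longrightarrow> w A \<le> w B \<Longrightarrow>
      A \<inter> B = {} \<Longrightarrow> is_sign \<epsilon> \<Longrightarrow> is_sign \<delta> \<Longrightarrow> norm (sgsum \<epsilon> A) \<le> D * norm (sgsum \<delta> B)"
    using assms(1) by (rule disjoint_superdemocraticE) (rule that, assumption, simp)
  have bound: "norm (x + sgsum \<epsilon> A) \<le> (C + D * (1 + C)) * norm (x + sgsum \<delta> B)"
    if A: "finite A" and B: "finite B" and AB: "w A \<le> w B" and \<epsilon>: "is_sign \<epsilon>" and \<delta>: "is_sign \<delta>"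
      and x: "coord_sup_norm smul e x \<le> 1" and dis: "A \<inter> B = {}" "A \<inter> supp smul e x = {}"
        "B \<inter> supp smul e x = {}" for A B \<epsilon> \<delta> x
  proof -
    define y where "y = x + sgsum \<delta> B"
    have x1: "norm (coef n x) \<le> 1" for n using norm_coord_le_sup[OF sn, of n x] x by linarith
    have coef_y: "coef n y = (if n \<in> B then \<delta> n else coef n x)" for n
      using dis by (auto simp: y_def coord_add coord_signed_sum B supp_def)
    have G: "greedy_set smul e y (card B) B"
      using B x1 \<delta> by (auto simp: greedy_set_def coef_y is_sign_def)
    have PB: "P B y = sgsum \<delta> B" unfolding proj_def signed_sum_def by (simp add: coef_y)
    have "norm (x + sgsum \<epsilon> A) \<le> norm x + norm (sgsum \<epsilon> A)" by (rule norm_triangle_ineq)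
    also have "norm x \<le> C * norm y"
      using norm_greedy_remainder[OF G] by (simp add: PB) (simp add: y_def)
    also have "norm (sgsum \<epsilon> A) \<le> D * norm (sgsum \<delta> B)" by (rule le[OF A B AB dis(1) \<epsilon> \<delta>])
    also have "\<dots> \<le> D * ((1 + C) * norm y)"
      using norm_greedy_sum[OF G] D by (intro mult_left_mono) (auto simp: PB)
    finally show ?thesis by (simp add: y_def algebra_simps)
  qed
  have one: "1 \<le> C + D * (1 + C)" using C_ge_1 D by (simp add: add_increasing2)
  show ?thesis by (rule property_AI[OF one]) (rule bound)
qed

lemma almost_greedy_if_superdemocratic:
  assumes "disjoint_superdemocratic smul e w" and w: "set_weight w"
  shows "almost_greedy smul e w"
proof -
  obtain D where D: "1 \<le> D" and le: "\<And>A B \<epsilon> \<delta>. finite A \<Longrightarrow> finite B \<Longrightarrow> w A \<le> w B \<Longrightarrow>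
      A \<inter> B = {} \<Longrightarrow> is_sign \<epsilon> \<Longrightarrow> is_sign \<delta> \<Longrightarrow> norm (sgsum \<epsilon> A) \<le> D * norm (sgsum \<delta> B)"
    using assms(1) by (rule disjoint_superdemocraticE) (rule that, assumption, simp)
  \<comment> \<open>The first summand is for the greedy remainder of \<open>u\<close>. The second
    multiplies the costs of comparing coefficients with signs, of superdemocracy and of
    truncation.\<close>
  define K where "K = C + 4 * C * (D * (C * (1 + C)))"
  have K: "1 \<le> K" using C_ge_1 D unfolding K_def by (simp add: add_increasing2)
  have bound: "norm (x - P \<Lambda> x) \<le> K * norm (x - P A x)"
    if gr: "greedy_set smul e x m \<Lambda>" and A: "finite A" and wA: "w (A - \<Lambda>) \<le> w (\<Lambda> - A)" for x m \<Lambda> A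
  proof (cases "\<Lambda> - A = {}")
    case True
    \<comment> \<open>The right-hand weight is 0, and only the empty set has weight 0.\<close>
    then have "A - \<Lambda> = {}" using wA w unfolding set_weight_def by (metis le_zero_eq less_irrefl)
    with True have "\<Lambda> = A" by blast
    then show ?thesis using K by (simp add: mult_le_cancel_right1)
  next
    case False
    have fin: "finite \<Lambda>" and gr': "\<And>n k. n \<in> \<Lambda> \<Longrightarrow> k \<notin> \<Lambda> \<Longrightarrow> norm (coef k x) \<le> norm (coef n x)"
      using gr by (auto simp: greedy_set_def)
    define u where "u = x - P A x"
    \<comment> \<open>This threshold separates the coefficients of \<open>x\<close> on
      \<open>\<Lambda> - A\<close> from those on \<open>A - \<Lambda>\<close>.\<close>
    define t where "t = Min ((\<lambda>n. norm (coef n x)) ` (\<Lambda> - A))"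
    have t_in: "t \<in> (\<lambda>n. norm (coef n x)) ` (\<Lambda> - A)"
      unfolding t_def using fin False by (intro Min_in) auto
    then have t0: "0 \<le> t" by auto
    have t_le: "t \<le> norm (coef n x)" if "n \<in> \<Lambda> - A" for n
      unfolding t_def using fin that by (intro Min_le) auto
    have t_ge: "norm (coef n x) \<le> t" if "n \<in> A - \<Lambda>" for n
      using t_in gr' that by auto
    have cu: "coef n u = (if n \<in> A then 0 else coef n x)" for n
      using A by (simp add: u_def coord_diff coord_proj)
    \<comment> \<open>An index outside \<open>\<Lambda> - A\<close> lies in \<open>A\<close>, where
      \<open>u\<close> has coefficient 0, or outside \<open>\<Lambda>\<close>, where greediness for
      \<open>x\<close> applies.\<close>
    have G: "greedy_set smul e u (card (\<Lambda> - A)) (\<Lambda> - A)"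
      using fin gr' by (auto simp: greedy_set_def cu)
    obtain \<delta> where \<delta>: "is_sign \<delta>" and trunc: "t * norm (sgsum \<delta> (\<Lambda> - A)) \<le> C * (1 + C) * norm u"
      using truncation_le_norm[OF G t0] t_le by (auto simp: cu)
    have "P (\<Lambda> - A) u = P (\<Lambda> - A) x" unfolding proj_def by (intro sum.cong) (auto simp: cu)
    moreover have "P A x = P (A - \<Lambda>) x + P (A \<inter> \<Lambda>) x" "P \<Lambda> x = P (\<Lambda> - A) x + P (A \<inter> \<Lambda>) x"
      unfolding proj_def using A fin
      by (subst sum.union_disjoint[symmetric]; auto intro!: sum.cong)+
    ultimately have "x - P \<Lambda> x = (u - P (\<Lambda> - A) u) + P (A - \<Lambda>) x"
      by (simp add: u_def)
    then have "norm (x - P \<Lambda> x) \<le> norm (u - P (\<Lambda> - A) u) + norm (P (A - \<Lambda>) x)"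
      by (simp add: norm_triangle_ineq)
    also have "norm (u - P (\<Lambda> - A) u) \<le> C * norm u" by (rule norm_greedy_remainder[OF G])
    also have "norm (P (A - \<Lambda>) x) \<le> 4 * C * (t * norm (sgsum \<delta> (A - \<Lambda>)))"
      unfolding proj_def using A t_ge by (intro norm_sum_le_signed_sum \<delta> t0) auto
    also have "\<dots> \<le> 4 * C * (t * (D * norm (sgsum \<delta> (\<Lambda> - A))))"
      using C_ge_1 t0 A fin wA \<delta> by (intro mult_left_mono le) auto
    also have "\<dots> = 4 * C * (D * (t * norm (sgsum \<delta> (\<Lambda> - A))))" by simp
    also have "\<dots> \<le> 4 * C * (D * (C * (1 + C) * norm u))"
      using C_ge_1 D trunc by (intro mult_left_mono) auto
    finally show ?thesis by (simp add: K_def u_def[symmetric] algebra_simps)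
  qed
  have error: "norm (x - P \<Lambda> x) \<le> K * almost_greedy_error smul e w \<Lambda> x"
    if gr: "greedy_set smul e x m \<Lambda>" for x m \<Lambda>
  proof -
    \<comment> \<open>Dividing by \<open>K\<close> gives a lower bound for all competitors, hence
      for their infimum; the empty set shows that competitors exist.\<close>
    have "norm (x - P \<Lambda> x) / K \<le> almost_greedy_error smul e w \<Lambda> x"
      unfolding almost_greedy_error_def
    proof (rule cInf_greatest)
      show "{norm (x - P A x) |A. finite A \<and> w (A - \<Lambda>) \<le> w (\<Lambda> - A)} \<noteq> {}"
        using w by (auto simp: set_weight_def intro!: exI[of _ "{}"])
      show "norm (x - P \<Lambda> x) / K \<le> r"
        if "r \<in> {norm (x - P A x) |A. finite A \<and> w (A - \<Lambda>) \<le> w (\<Lambda> - A)}" for r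
        using that bound[OF gr] K by (auto simp: field_simps)
    qed
    then show ?thesis using K by (simp add: field_simps)
  qed
  show ?thesis unfolding almost_greedy_def by (intro exI[of _ K] conjI allI impI K) (rule error)
qed

end

section \<open>Assembling the equivalences\<close>

lemma (in schauder_space) quasi_greedy_spaceE:
  assumes "quasi_greedy smul e"
  obtains C where "quasi_greedy_space smul e C"
proof -
  obtain C where C: "1 \<le> C" and le: "\<And>x m \<Lambda>. 1 \<le> m \<Longrightarrow> greedy_set smul e x m \<Lambda> \<Longrightarrow>
      norm (x - P \<Lambda> x) \<le> C * norm x"
    using assms unfolding quasi_greedy_def by blast
  have "norm (x - P \<Lambda> x) \<le> C * norm x" if "greedy_set smul e x m \<Lambda>" for x m \<Lambda>
  \<comment> \<open>The locale admits order 0, the definition does not; there the remainder is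
    \<open>x\<close> itself and \<open>1 \<le> C\<close> suffices.\<close>
  proof (cases "m = 0")
    case True
    then have "\<Lambda> = {}" using that by (auto simp: greedy_set_def)
    then show ?thesis using C by (simp add: proj_def mult_le_cancel_right1)
  qed (use le[of m x \<Lambda>] that in auto)
  with C have "quasi_greedy_space smul e C" by unfold_locales auto
  then show thesis by (rule that)
qed

theorem theorem2p10:
  fixes smul :: "'k::real_or_complex \<Rightarrow> 'a::banach \<Rightarrow> 'a"
    and e :: "nat \<Rightarrow> 'a"
    and w :: "nat set \<Rightarrow> ennreal"
  assumes "banach_space_over smul"
    and "schauder_basis smul e"
    and "semi_normalized e"
    and "set_weight w"
  shows "(almost_greedy smul e w \<longleftrightarrow> quasi_greedy smul e \<and> property_A smul e w) \<and>
         (quasi_greedy smul e \<and> property_A smul e w \<longleftrightarrow>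
            quasi_greedy smul e \<and> disjoint_superdemocratic smul e w) \<and>
         (quasi_greedy smul e \<and> disjoint_superdemocratic smul e w \<longleftrightarrow>
            quasi_greedy smul e \<and> disjoint_democratic e w)"
proof -
  interpret schauder_space smul e
    using assms(1,2) by (simp add: schauder_space_def schauder_space_axioms_def)
  \<comment> \<open>Condition (3) is the hub: under quasi-greediness, (4) implies it and it implies
    (1) and (2). The earlier implications lead from (1) to (2), (3) and (4).\<close>
  have "disjoint_superdemocratic smul e w" if "quasi_greedy smul e" "disjoint_democratic e w"
    using quasi_greedy_spaceE[OF that(1)]
      quasi_greedy_space.disjoint_superdemocratic_if_democratic[OF _ that(2)] by blast
  moreover have "property_A smul e w" "almost_greedy smul e w"
    if "quasi_greedy smul e" "disjoint_superdemocratic smul e w"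
    using quasi_greedy_spaceE[OF that(1)]
      quasi_greedy_space.property_A_if_superdemocratic[OF _ that(2) assms(3)]
      quasi_greedy_space.almost_greedy_if_superdemocratic[OF _ that(2) assms(4)] by blast+
  ultimately show ?thesis
    using quasi_greedy_if_almost_greedy[OF _ assms(4)]
      property_A_if_almost_greedy[OF _ assms(4,3)]
      disjoint_superdemocratic_if_property_A disjoint_democratic_if_superdemocratic
    by blast
qed

end
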